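(* Let $n$ be an odd perfect number, written in the form $n=\pi^\alpha M^2$, where $\pi$ is prime, $\alpha$ and $M$ are positive integers, $\gcd(\pi,M)=1$ and $\pi\equiv\alpha\equiv 1\pmod 4$. If $\alpha+2$ is prime, then $$\bigl(n\equiv(\alpha+2)^2\pmod{4(\alpha+2)^2}\bigr)\ \text{ or }\ \bigl(\pi\equiv 1\pmod{4(\alpha+2)}\bigr).$$
   Context: A positive integer $n$ is perfect if $\sigma(n)=2n$, where $\sigma(n)$ is the sum of the positive divisors of $n$. By Euler's theorem every odd perfect number $n$ has such a representation $n=\pi^\alpha M^2$; $\pi$ is the unique prime dividing $n$ to an odd power and $\alpha$ is its exponent. *)

theory Defs
  imports "HOL-Number_Theory.Number_Theory"
begin

definition divisor_sum :: "nat \<Rightarrow> nat" where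
  "divisor_sum n = (\<Sum>d | d dvd n. d)"

definition perfect :: "nat \<Rightarrow> bool" where
  "perfect n \<longleftrightarrow> 0 < n \<and> divisor_sum n = 2 * n"

end

theory Submission
  imports Defs
begin

text \<open>
  Put \<open>q = \<alpha> + 2\<close>, a prime congruent to 3 modulo 4, so \<open>q \<noteq> p\<close>. If \<open>p\<close> is not 1 modulo \<open>q\<close>, then
  Fermat's little theorem makes \<open>q\<close> divide \<open>(p\<^sup>q\<^sup>-\<^sup>1 - 1) / (p - 1) = \<sigma>(p\<^sup>\<alpha>)\<close>, which divides
  \<open>\<sigma>(n) = 2n\<close>. Hence \<open>q\<close> divides \<open>M\<close>, so \<open>n\<close> is divisible by \<open>q\<^sup>2\<close>, while \<open>n\<close> and \<open>q\<^sup>2\<close> are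
  both 1 modulo 4.
\<close>

text \<open>Multiplication maps pairs of divisors of \<open>a\<close> and \<open>b\<close>
  bijectively to the divisors of \<open>a * b\<close>, so the product of the two sums reindexes to a
  single sum.\<close>

lemma divisor_sum_mult_coprime:
  assumes "coprime a b"
  shows "divisor_sum (a * b) = divisor_sum a * divisor_sum b"
proof -
  have inj: "inj_on (\<lambda>(x, y). x * y) ({d. d dvd a} \<times> {d. d dvd b})"
  proof (rule inj_onI, clarify)
    fix x y x' y' :: nat
    assume d: "x dvd a" "y dvd b" "x' dvd a" "y' dvd b" and eq: "x * y = x' * y'"
    \<comment> \<open>These cross coprimalities let \<open>x * y = x' * y'\<close> be compared
      factor by factor.\<close>
    have "coprime x y'" "coprime x' y"
      using d assms coprime_divisors by blast+
    then show "x = x' \<and> y = y'"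
      using eq coprime_crossproduct_nat[of x y' x' y]
      by (simp add: mult.commute)
  qed
  have img: "(\<lambda>(x, y). x * y) ` ({d. d dvd a} \<times> {d. d dvd b}) = {d. d dvd a * b}"
    by (auto simp: image_iff intro: mult_dvd_mono dest: division_decomp)
  have "divisor_sum a * divisor_sum b = (\<Sum>(x, y)\<in>{d. d dvd a} \<times> {d. d dvd b}. x * y)"
    unfolding divisor_sum_def sum_product sum.cartesian_product ..
  also have "\<dots> = divisor_sum (a * b)"
    unfolding divisor_sum_def img[symmetric] sum.reindex[OF inj]
    by (simp add: case_prod_unfold)
  finally show ?thesis ..
qed

lemma divisor_sum_prime_power:
  assumes "prime p"
  shows "divisor_sum (p ^ k) = (\<Sum>i\<le>k. p ^ i)"
proof -
  have "{d. d dvd p ^ k} = (\<lambda>i. p ^ i) ` {..k}"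
    using assms by (auto simp: divides_primepow_nat intro: le_imp_power_dvd)
  moreover have "inj_on (\<lambda>i. p ^ i) {..k}"
    using prime_gt_1_nat[OF assms] by (auto intro!: inj_onI dest: power_inject_exp[THEN iffD1])
  ultimately show ?thesis
    by (simp add: divisor_sum_def sum.reindex)
qed

text \<open>Multiplied by \<open>p - 1\<close>, the geometric sum becomes
  \<open>p ^ (q - 1) - 1\<close>, a multiple of \<open>q\<close> by Fermat; since \<open>q\<close>
  is prime and does not divide \<open>p - 1\<close>, it divides the sum.\<close>

lemma prime_dvd_sum_powers:
  fixes p q :: nat
  assumes "prime q" and "\<not> q dvd p" and "\<not> [p = 1] (mod q)"
  shows "q dvd (\<Sum>i\<le>q - 2. p ^ i)"
proof -
  have q: "2 \<le> q" using assms(1) by (rule prime_ge_2_nat)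
  \<comment> \<open>The factorisation takes place in \<open>int\<close>, where subtraction is not
    truncated.\<close>
  have "[int p ^ (q - 1) = 1] (mod int q)"
    using fermat_theorem[OF assms(1,2)] by (metis cong_int_iff of_nat_1 of_nat_power)
  then have "int q dvd int p ^ (q - 1) - 1"
    by (simp add: cong_iff_dvd_diff)
  also have "int p ^ (q - 1) - 1 = (int p - 1) * (\<Sum>i<q - 1. int p ^ i)"
    by (rule power_diff_1_eq)
  also have "{..<q - 1} = {..q - 2}" using q by auto
  finally have "int q dvd int p - 1 \<or> int q dvd (\<Sum>i\<le>q - 2. int p ^ i)"
    using assms(1) by (simp add: prime_dvd_mult_iff)
  moreover have "\<not> int q dvd int p - 1"
    using assms(3) by (metis cong_iff_dvd_diff cong_int_iff of_nat_1)
  ultimately have "int q dvd int (\<Sum>i\<le>q - 2. p ^ i)" by simp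
  then show ?thesis by (simp only: int_dvd_int_iff)
qed

theorem theorem2:
  fixes n p \<alpha> M :: nat
  assumes "odd n" and "perfect n"
    and "n = p ^ \<alpha> * M\<^sup>2"
    and "prime p" and "0 < \<alpha>" and "0 < M"
    and "gcd p M = 1"
    and "[p = \<alpha>] (mod 4)" and "[\<alpha> = 1] (mod 4)"
    and "prime (\<alpha> + 2)"
  shows "[n = (\<alpha> + 2)\<^sup>2] (mod (4 * (\<alpha> + 2)\<^sup>2)) \<or> [p = 1] (mod (4 * (\<alpha> + 2)))"
proof -
  define q where "q = \<alpha> + 2"
  have q: "prime q" using assms(10) by (simp add: q_def)
  have p4: "[p = 1] (mod 4)" using assms(8,9) by (rule cong_trans)
  have q4: "q mod 4 = 3" using assms(9) by (simp add: q_def cong_def) presburger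
  have "odd q" using q4 by presburger
  \<comment> \<open>This glues a congruence modulo 4 to one modulo \<open>q\<close> in the first
    case below and modulo \<open>q\<^sup>2\<close> in the second.\<close>
  then have cop4: "coprime 4 q"
    using coprime_power_left_iff[of 2 2 q] by simp
  have neq: "q \<noteq> p" using p4 q4 by (auto simp: cong_def)
  have odd_square: "[x\<^sup>2 = 1] (mod 4)" if "odd x" for x :: nat
  proof -
    from that obtain k where "x = 2 * k + 1" by (rule oddE)
    then have "x\<^sup>2 = 4 * (k\<^sup>2 + k) + 1" by (simp add: power2_eq_square algebra_simps)
    then show ?thesis by (simp add: cong_def)
  qed
  show ?thesis
  proof (cases "[p = 1] (mod q)")
    case True
    with p4 cop4 have "[p = 1] (mod (4 * q))" by (simp add: coprime_cong_mult_nat)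
    then show ?thesis by (simp add: q_def)
  next
    case False
    have "\<not> q dvd p" using q neq assms(4) primes_dvd_imp_eq by blast
    \<comment> \<open>Since \<open>q - 2 = \<alpha>\<close>, the geometric sum ends exactly at
      \<open>p ^ \<alpha>\<close>.\<close>
    with q False have "q dvd divisor_sum (p ^ \<alpha>)"
      using prime_dvd_sum_powers[of q p] divisor_sum_prime_power[OF assms(4), of \<alpha>]
      by (simp add: q_def)
    moreover have "divisor_sum (p ^ \<alpha>) * divisor_sum (M\<^sup>2) = 2 * n"
    proof -
      have "coprime p M" using assms(7) by (rule gcd_eq_1_imp_coprime)
      then have "coprime (p ^ \<alpha>) (M\<^sup>2)" by simp
      from divisor_sum_mult_coprime[OF this] show ?thesis
        unfolding assms(3)[symmetric] using assms(2) by (simp add: perfect_def)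
    qed
    ultimately have "q dvd 2 * n"
      by (metis dvd_mult2)
    then have "q dvd n"
      using \<open>odd q\<close> by (simp add: coprime_dvd_mult_right_iff)
    then have "q dvd p ^ \<alpha> \<or> q dvd M\<^sup>2"
      unfolding assms(3) prime_dvd_mult_iff[OF q] .
    \<comment> \<open>Dividing \<open>p ^ \<alpha>\<close> would force \<open>q dvd p\<close>, so
      only the factor \<open>M\<^sup>2\<close> remains.\<close>
    then have "q dvd M"
      using prime_dvd_power[OF q] \<open>\<not> q dvd p\<close> by blast
    then have "q\<^sup>2 dvd n" using assms(3) by (simp add: dvd_power_same)
    then have "[n = q\<^sup>2] (mod q\<^sup>2)" by (simp add: cong_def)
    moreover have "[n = q\<^sup>2] (mod 4)"
    proof -
      have "odd M" using assms(1) unfolding assms(3) by simp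
      \<comment> \<open>The right side is left unsimplified to match the congruence rules for
        products and powers.\<close>
      then have "[p ^ \<alpha> * M\<^sup>2 = 1 ^ \<alpha> * 1] (mod 4)"
        using p4 odd_square by (intro cong_mult cong_pow)
      then show ?thesis
        using assms(3) odd_square[OF \<open>odd q\<close>] by (simp add: cong_def)
    qed
    ultimately have "[n = q\<^sup>2] (mod (4 * q\<^sup>2))"
      using cop4 by (simp add: coprime_cong_mult_nat)
    then show ?thesis by (simp add: q_def)
  qed
qed

end
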